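(* Let $\Phi=(\phi_n)$ be a frame for $\mathcal H$ with $\phi_n\neq 0$ for all $n$, let $G:\mathcal H\to\mathcal H$ be a bounded bijective linear operator and let $\psi_n=G\phi_n$ for all $n$, $\Psi=(\psi_n)$. Let $m=(m_n)$ be a real sequence that is positive (resp. negative), i.e. $m_n>0$ for all $n$ (resp. $m_n<0$ for all $n$), and semi-normalized. Then $\Psi$ is a frame for $\mathcal H$, the multipliers $M_{m,\Phi,\Psi}$ and $M_{m,\Psi,\Phi}$ are invertible on $\mathcal H$, and $$M_{m,\Phi,\Psi}^{-1}=\begin{cases}(G^{-1})^*S^{-1}_{(\sqrt{m_n}\,\phi_n)},&\text{when } m_n>0\ \forall n,\\ -(G^{-1})^*S^{-1}_{(\sqrt{|m_n|}\,\phi_n)},&\text{when } m_n<0\ \forall n,\end{cases}$$ $$M_{m,\Psi,\Phi}^{-1}=\begin{cases}S^{-1}_{(\sqrt{m_n}\,\phi_n)}G^{-1},&\text{when } m_n>0\ \forall n,\\ -S^{-1}_{(\sqrt{|m_n|}\,\phi_n)}G^{-1},&\text{when } m_n<0\ \forall n.\end{cases}$$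
   Context: $\mathcal H$ is a separable infinite-dimensional complex Hilbert space, inner product linear in the first argument; all sequences are indexed by $\mathbb N$. The multiplier is $M_{m,\Phi,\Psi}f=\sum_n m_n\langle f,\psi_n\rangle\phi_n$; it is invertible on $\mathcal H$ if the series converges for every $f\in\mathcal H$ and the resulting operator has a bounded two-sided inverse $\mathcal H\to\mathcal H$. A frame for $\mathcal H$ is a sequence $\Phi$ for which there are $0<A\le B<\infty$ with $A\|h\|^2\le\sum|\langle h,\phi_n\rangle|^2\le B\|h\|^2$ for all $h\in\mathcal H$; its frame operator is $S_\Phi h=\sum\langle h,\phi_n\rangle\phi_n$, which is invertible on $\mathcal H$. A scalar sequence $m$ is semi-normalized if $0<a\le|m_n|\le b<\infty$ for all $n$, for some constants $a,b$ (for such $m$, $(\sqrt{|m_n|}\,\phi_n)$ is again a frame). *)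

theory Defs
  imports "HOL-Analysis.Analysis"
begin

section \<open>Complex Hilbert spaces\<close>

text \<open>
  The class extends \<^class>\<open>banach\<close>, so that completeness, limits and series are those of the
  library; the norm is the one induced by the inner product.  The inner product is linear in
  its first argument.
\<close>

class complex_vector = real_vector +
  fixes scaleC :: "complex \<Rightarrow> 'a \<Rightarrow> 'a" (infixr "*\<^sub>C" 75)
  assumes scaleC_add_right: "a *\<^sub>C (x + y) = a *\<^sub>C x + a *\<^sub>C y"
    and scaleC_add_left: "(a + b) *\<^sub>C x = a *\<^sub>C x + b *\<^sub>C x"
    and scaleC_scaleC [simp]: "a *\<^sub>C (b *\<^sub>C x) = (a * b) *\<^sub>C x"
    and scaleC_one [simp]: "1 *\<^sub>C x = x"
    and scaleR_scaleC: "r *\<^sub>R x = complex_of_real r *\<^sub>C x"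

global_interpretation complex_vector: vector_space "scaleC :: complex \<Rightarrow> 'a \<Rightarrow> 'a::complex_vector"
  by unfold_locales (simp_all add: scaleC_add_right scaleC_add_left)

class complex_hilbert_space = complex_vector + banach +
  fixes cinner :: "'a \<Rightarrow> 'a \<Rightarrow> complex"
  assumes cinner_commute: "cinner x y = cnj (cinner y x)"
    and cinner_add_left: "cinner (x + y) z = cinner x z + cinner y z"
    and cinner_scaleC_left [simp]: "cinner (a *\<^sub>C x) y = a * cinner x y"
    and cinner_ge_zero [simp]: "0 \<le> Re (cinner x x)"
    and cinner_eq_zero_iff [simp]: "cinner x x = 0 \<longleftrightarrow> x = 0"
    and norm_eq_sqrt_cinner: "norm x = sqrt (Re (cinner x x))"

definition bounded_clinear :: "('a::complex_hilbert_space \<Rightarrow> 'b::complex_hilbert_space) \<Rightarrow> bool" where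
  "bounded_clinear T \<longleftrightarrow>
     Vector_Spaces.linear scaleC scaleC T \<and> (\<exists>K. \<forall>x. norm (T x) \<le> norm x * K)"

definition cadjoint :: "('a::complex_hilbert_space \<Rightarrow> 'b::complex_hilbert_space) \<Rightarrow> 'b \<Rightarrow> 'a" where
  "cadjoint T = (THE T'. \<forall>x y. cinner (T x) y = cinner x (T' y))"

section \<open>Frames and multipliers\<close>

definition is_frame :: "(nat \<Rightarrow> 'a::complex_hilbert_space) \<Rightarrow> bool" where
  "is_frame \<phi> \<longleftrightarrow> (\<exists>A B. 0 < A \<and> A \<le> B \<and>
     (\<forall>h. summable (\<lambda>n. (cmod (cinner h (\<phi> n)))\<^sup>2) \<and>
          A * (norm h)\<^sup>2 \<le> (\<Sum>n. (cmod (cinner h (\<phi> n)))\<^sup>2) \<and>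
          (\<Sum>n. (cmod (cinner h (\<phi> n)))\<^sup>2) \<le> B * (norm h)\<^sup>2))"

definition frame_operator :: "(nat \<Rightarrow> 'a::complex_hilbert_space) \<Rightarrow> 'a \<Rightarrow> 'a" where
  "frame_operator \<phi> h = (\<Sum>n. cinner h (\<phi> n) *\<^sub>C \<phi> n)"

definition multiplier ::
    "(nat \<Rightarrow> complex) \<Rightarrow> (nat \<Rightarrow> 'a::complex_hilbert_space) \<Rightarrow> (nat \<Rightarrow> 'a) \<Rightarrow> 'a \<Rightarrow> 'a" where
  "multiplier m \<phi> \<psi> f = (\<Sum>n. m n *\<^sub>C cinner f (\<psi> n) *\<^sub>C \<phi> n)"

definition multiplier_invertible ::
    "(nat \<Rightarrow> complex) \<Rightarrow> (nat \<Rightarrow> 'a::complex_hilbert_space) \<Rightarrow> (nat \<Rightarrow> 'a) \<Rightarrow> bool" where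
  "multiplier_invertible m \<phi> \<psi> \<longleftrightarrow>
     (\<forall>f. summable (\<lambda>n. m n *\<^sub>C cinner f (\<psi> n) *\<^sub>C \<phi> n)) \<and>
     (\<exists>N. bounded_clinear N \<and> N \<circ> multiplier m \<phi> \<psi> = id \<and> multiplier m \<phi> \<psi> \<circ> N = id)"

definition semi_normalized :: "(nat \<Rightarrow> complex) \<Rightarrow> bool" where
  "semi_normalized m \<longleftrightarrow> (\<exists>a b. 0 < a \<and> (\<forall>n. a \<le> cmod (m n) \<and> cmod (m n) \<le> b))"

end

theory Submission
  imports Defs
begin

text \<open>
  Writing \<open>S\<close> for the frame operator of \<open>(\<surd>\<bar>m\<^sub>n\<bar> \<phi>\<^sub>n)\<close>, for positive \<open>m\<close> the identity
  \<open>\<langle>f, G \<phi>\<^sub>n\<rangle> = \<langle>G\<^sup>* f, \<phi>\<^sub>n\<rangle>\<close> gives \<open>M\<^bsub>m,\<Phi>,\<Psi>\<^esub> = S G\<^sup>*\<close> and \<open>M\<^bsub>m,\<Psi>,\<Phi>\<^esub> = G S\<close>; a negative \<open>m\<close>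
  only changes the sign.  The operator \<open>S\<close> is coercive, so it is invertible by Lax--Milgram.
  Adjoints are obtained from the frame itself, by expanding in it, and the boundedness of \<open>G\<^sup>-\<^sup>1\<close>
  follows from uniform boundedness: \<open>G\<^sup>*\<close> is bounded below because \<open>G\<close> is onto, so \<open>G G\<^sup>*\<close> is
  coercive and \<open>G\<^sup>-\<^sup>1 = G\<^sup>* (G G\<^sup>*)\<^sup>-\<^sup>1\<close>.
\<close>

section \<open>The inner product\<close>

lemma cinner_add_right: "cinner x (y + z) = cinner x y + cinner x z"
  using cinner_add_left[of y z x]
  by (simp add: cinner_commute[of x "y + z"] cinner_commute[of x y] cinner_commute[of x z])

lemma cinner_scaleC_right [simp]: "cinner x (a *\<^sub>C y) = cnj a * cinner x y"
  by (simp add: cinner_commute[of x "a *\<^sub>C y"] cinner_commute[of x y])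

lemma cinner_scaleR_left [simp]: "cinner (r *\<^sub>R x) y = of_real r * cinner x y"
  by (simp add: scaleR_scaleC)

lemma cinner_scaleR_right [simp]: "cinner x (r *\<^sub>R y) = of_real r * cinner x y"
  by (simp add: scaleR_scaleC)

lemma cinner_minus_left [simp]: "cinner (- x) y = - cinner x y"
  using cinner_scaleR_left[of "-1" x y] by simp

lemma cinner_minus_right [simp]: "cinner x (- y) = - cinner x y"
  using cinner_scaleR_right[of x "-1" y] by simp

lemma cinner_diff_left: "cinner (x - y) z = cinner x z - cinner y z"
  using cinner_add_left[of x "- y" z] by simp

lemma cinner_diff_right: "cinner x (y - z) = cinner x y - cinner x z"
  using cinner_add_right[of x y "- z"] by simp

lemma Im_cinner_self [simp]: "Im (cinner x x) = 0"
  using arg_cong[OF cinner_commute[of x x], of Im] by simp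

lemma power2_norm_eq_cinner: "(norm x)\<^sup>2 = Re (cinner x x)"
  by (simp add: norm_eq_sqrt_cinner)

lemma cinner_self: "cinner x x = complex_of_real ((norm x)\<^sup>2)"
  by (simp add: complex_eq_iff power2_norm_eq_cinner)

lemma norm_scaleC [simp]: "norm (a *\<^sub>C x) = cmod a * norm (x :: 'a::complex_hilbert_space)"
proof (rule power2_eq_imp_eq)
  have "cinner (a *\<^sub>C x) (a *\<^sub>C x) = (a * cnj a) * cinner x x"
    by (simp add: mult.commute mult.left_commute)
  also have "\<dots> = complex_of_real ((cmod a * norm x)\<^sup>2)"
    by (simp add: complex_norm_square[symmetric] cinner_self power_mult_distrib)
  finally have "complex_of_real ((norm (a *\<^sub>C x))\<^sup>2) = complex_of_real ((cmod a * norm x)\<^sup>2)"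
    by (simp only: cinner_self)
  then show "(norm (a *\<^sub>C x))\<^sup>2 = (cmod a * norm x)\<^sup>2"
    by (simp only: of_real_eq_iff)
qed auto

lemma cmod_cinner_le: "cmod (cinner x y) \<le> norm x * norm y"
proof (cases "y = 0")
  case True
  then show ?thesis
    using cinner_scaleR_right[of x 0 0] by simp
next
  case False
  define n2 where "n2 = (norm y)\<^sup>2"
  define a where "a = cinner x y / of_real n2"
  have n2: "n2 > 0"
    using False by (simp add: n2_def)
  have yy: "cinner y y = of_real n2" and yx: "cinner y x = cnj (cinner x y)"
    by (simp_all add: cinner_self n2_def cinner_commute[of y x])
  have "cinner (x - a *\<^sub>C y) (x - a *\<^sub>C y)
      = cinner x x - a * cnj (cinner x y) - cnj a * (cinner x y - a * of_real n2)"
    by (simp add: cinner_diff_left cinner_diff_right yy yx algebra_simps)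
  also have "\<dots> = of_real ((norm x)\<^sup>2) - of_real ((cmod (cinner x y))\<^sup>2 / n2)"
    using n2 by (simp add: a_def cinner_self complex_norm_square[symmetric])
  finally have "Re (cinner (x - a *\<^sub>C y) (x - a *\<^sub>C y)) = (norm x)\<^sup>2 - (cmod (cinner x y))\<^sup>2 / n2"
    by simp
  then have "(cmod (cinner x y))\<^sup>2 / n2 \<le> (norm x)\<^sup>2"
    by (metis cinner_ge_zero diff_ge_0_iff_ge)
  then have "(cmod (cinner x y))\<^sup>2 \<le> (norm x * norm y)\<^sup>2"
    using n2 by (simp add: n2_def field_simps power_mult_distrib)
  then show ?thesis
    by (rule power2_le_imp_le) simp
qed

lemma bounded_linear_cinner_left: "bounded_linear (\<lambda>x. cinner x y)"
  by (rule bounded_linear_intro[where K = "norm y"])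
    (simp_all add: cinner_add_left cmod_cinner_le scaleR_conv_of_real)

lemma bounded_linear_cinner_right: "bounded_linear (\<lambda>y. cinner x y)"
  by (rule bounded_linear_intro[where K = "norm x"])
    (simp_all add: cinner_add_right cmod_cinner_le scaleR_conv_of_real mult.commute[of "norm _" "norm x"])

lemma cinner_eqI:
  assumes "\<And>z. cinner z x = cinner z y"
  shows "x = y"
proof -
  have "cinner (x - y) (x - y) = 0"
    using assms[of "x - y"] by (simp add: cinner_diff_right)
  then show ?thesis
    by simp
qed

section \<open>Bounded operators\<close>

lemma bounded_clinearI:
  assumes "\<And>x y. T (x + y) = T x + T y" "\<And>a x. T (a *\<^sub>C x) = a *\<^sub>C T x"
    and "\<And>x. norm (T x) \<le> K * norm x"
  shows "bounded_clinear T"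
proof -
  have "Vector_Spaces.linear scaleC scaleC T"
    by unfold_locales (simp_all add: assms(1,2) scaleC_add_right scaleC_add_left)
  then show ?thesis
    unfolding bounded_clinear_def using assms(3) by (metis mult.commute)
qed

lemma bounded_clinear_add: "bounded_clinear T \<Longrightarrow> T (x + y) = T x + T y"
  unfolding bounded_clinear_def Vector_Spaces.linear_def by (blast dest: module_hom.add)

lemma bounded_clinear_scaleC: "bounded_clinear T \<Longrightarrow> T (a *\<^sub>C x) = a *\<^sub>C T x"
  unfolding bounded_clinear_def Vector_Spaces.linear_def by (blast dest: module_hom.scale)

lemma bounded_clinear_bounded_linear:
  assumes "bounded_clinear T"
  shows "bounded_linear T"
proof -
  obtain K where "\<And>x. norm (T x) \<le> norm x * K"
    using assms unfolding bounded_clinear_def by blast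
  then show ?thesis
    by (intro bounded_linear_intro)
      (simp_all add: assms bounded_clinear_add bounded_clinear_scaleC scaleR_scaleC)
qed

lemma bounded_clinear_pos_bound:
  assumes "bounded_clinear T"
  obtains K where "0 < K" "\<And>x. norm (T x) \<le> K * norm x"
proof -
  obtain K where "0 < K" "\<And>x. norm (T x) \<le> norm x * K"
    using bounded_linear.pos_bounded[OF bounded_clinear_bounded_linear[OF assms]] by blast
  then show thesis
    by (intro that[of K]) (simp_all add: mult.commute)
qed

lemma bounded_clinear_compose:
  assumes "bounded_clinear S" "bounded_clinear T"
  shows "bounded_clinear (S \<circ> T)"
proof -
  obtain K where "\<And>x. norm (S (T x)) \<le> K * norm x"
    using bounded_linear.pos_bounded[OF bounded_linear_compose[OF
          bounded_clinear_bounded_linear[OF assms(1)] bounded_clinear_bounded_linear[OF assms(2)]]]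
    by (metis mult.commute)
  then show ?thesis
    by (intro bounded_clinearI[where K = K])
      (simp_all add: assms bounded_clinear_add bounded_clinear_scaleC)
qed

lemma bounded_clinear_minus:
  assumes "bounded_clinear T"
  shows "bounded_clinear (\<lambda>x. - T x)"
proof -
  obtain K where "\<And>x. norm (T x) \<le> K * norm x"
    using bounded_clinear_pos_bound[OF assms] by blast
  then show ?thesis
    by (intro bounded_clinearI[where K = K])
      (simp_all add: assms bounded_clinear_add bounded_clinear_scaleC)
qed

lemma bounded_clinear_inv_if_bounded_below:
  assumes T: "bounded_clinear T" "bij T" and "\<And>x. norm x \<le> K * norm (T x)"
  shows "bounded_clinear (inv T)"
proof (rule bounded_clinearI[where K = K])
  have inj: "inj T" and T_inv: "\<And>y. T (inv T y) = y"
    using T(2) by (simp_all add: bij_is_inj bij_is_surj surj_f_inv_f)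
  show "inv T (x + y) = inv T x + inv T y" for x y
    by (rule injD[OF inj]) (simp add: T_inv bounded_clinear_add[OF T(1)])
  show "inv T (a *\<^sub>C x) = a *\<^sub>C inv T x" for a x
    by (rule injD[OF inj]) (simp add: T_inv bounded_clinear_scaleC[OF T(1)])
  show "norm (inv T x) \<le> K * norm x" for x
    using assms(3)[of "inv T x"] by (simp add: T_inv)
qed

text \<open>For small \<open>t > 0\<close> the map \<open>x \<mapsto> x - t (T x - y)\<close> is a contraction, and its fixed
  point solves \<open>T x = y\<close>.\<close>

lemma lax_milgram:
  fixes T :: "'a::complex_hilbert_space \<Rightarrow> 'a"
  assumes T: "bounded_clinear T" and "0 < c" and coercive: "\<And>x. c * (norm x)\<^sup>2 \<le> Re (cinner (T x) x)"
  shows "bij T" "bounded_clinear (inv T)"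
proof -
  interpret bounded_linear T
    by (rule bounded_clinear_bounded_linear[OF T])
  obtain K0 where K0: "0 < K0" "\<And>x. norm (T x) \<le> K0 * norm x"
    using bounded_clinear_pos_bound[OF T] by blast
  define K where "K = max K0 c"
  have K: "0 < K" "c \<le> K" "\<And>x. norm (T x) \<le> K * norm x"
    using K0 by (auto simp: K_def intro: order_trans[OF K0(2) mult_right_mono])
  define t where "t = c / K\<^sup>2"
  define q where "q = 1 - c\<^sup>2 / K\<^sup>2"
  have q: "0 \<le> q" "q < 1"
    using K \<open>0 < c\<close> by (simp_all add: q_def power_mono)
  have contraction: "norm (z - t *\<^sub>R T z) \<le> sqrt q * norm z" for z
  proof -
    have "(norm (z - t *\<^sub>R T z))\<^sup>2 = Re (cinner (z - t *\<^sub>R T z) (z - t *\<^sub>R T z))"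
      by (rule power2_norm_eq_cinner)
    also have "\<dots> = Re (cinner z z) - t * Re (cinner z (T z)) - t * (Re (cinner (T z) z)
        - t * Re (cinner (T z) (T z)))"
      by (simp add: cinner_diff_left cinner_diff_right algebra_simps)
    also have "\<dots> = (norm z)\<^sup>2 - 2 * t * Re (cinner (T z) z) + t\<^sup>2 * (norm (T z))\<^sup>2"
      using arg_cong[OF cinner_commute[of z "T z"], of Re]
      by (simp add: power2_norm_eq_cinner power2_eq_square[of t] algebra_simps)
    also have "\<dots> \<le> (norm z)\<^sup>2 - 2 * t * (c * (norm z)\<^sup>2) + t\<^sup>2 * (K * norm z)\<^sup>2"
      using K \<open>0 < c\<close> by (intro add_mono diff_mono mult_left_mono coercive power_mono)
        (auto simp: t_def)
    also have "\<dots> = q * (norm z)\<^sup>2"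
      using K(1) by (simp add: q_def t_def field_simps power2_eq_square)
    finally have "(norm (z - t *\<^sub>R T z))\<^sup>2 \<le> (sqrt q * norm z)\<^sup>2"
      using q by (simp add: power_mult_distrib)
    then show ?thesis
      by (rule power2_le_imp_le) (use q in simp)
  qed
  have t: "0 < t"
    using K(1) \<open>0 < c\<close> by (simp add: t_def)
  have below: "norm x \<le> (1 / c) * norm (T x)" for x
  proof (cases "x = 0")
    case False
    have "c * (norm x)\<^sup>2 \<le> norm (T x) * norm x"
      using coercive[of x] complex_Re_le_cmod[of "cinner (T x) x"] cmod_cinner_le[of "T x" x] by linarith
    then show ?thesis
      using False \<open>0 < c\<close> by (simp add: power2_eq_square field_simps)
  qed simp
  show "bij T"
  proof (rule bijI)
    show "inj T"
    proof (rule injI)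
      fix x y
      assume "T x = T y"
      then have "T (x - y) = 0"
        by (simp add: diff)
      then show "x = y"
        using below[of "x - y"] by simp
    qed
    show "surj T"
    proof (rule surjI[where f = "\<lambda>y. THE x. x - t *\<^sub>R (T x - y) = x"])
      fix y
      have "\<exists>!x. x - t *\<^sub>R (T x - y) = x"
      proof (rule banach_fix_type)
        show "0 \<le> sqrt q" "sqrt q < 1"
          using q by auto
        have "dist (x - t *\<^sub>R (T x - y)) (x' - t *\<^sub>R (T x' - y)) = norm ((x - x') - t *\<^sub>R T (x - x'))" for x x'
          by (simp add: dist_norm diff algebra_simps)
        then show "\<forall>x x'. dist (x - t *\<^sub>R (T x - y)) (x' - t *\<^sub>R (T x' - y)) \<le> sqrt q * dist x x'"
          using contraction by (simp add: dist_norm)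
      qed
      then have "(THE x. x - t *\<^sub>R (T x - y) = x) - t *\<^sub>R (T (THE x. x - t *\<^sub>R (T x - y) = x) - y)
          = (THE x. x - t *\<^sub>R (T x - y) = x)"
        by (rule theI')
      then show "T (THE x. x - t *\<^sub>R (T x - y) = x) = y"
        using t by simp
    qed
  qed
  then show "bounded_clinear (inv T)"
    using T below by (intro bounded_clinear_inv_if_bounded_below)
qed

section \<open>Uniform boundedness and bounded inverses\<close>

lemma uniform_boundedness:
  fixes E :: "'a::complex_hilbert_space set"
  assumes "\<And>x. \<exists>M. \<forall>y\<in>E. cmod (cinner x y) \<le> M"
  shows "bounded E"
proof -
  define C where "C n = {x. \<forall>y\<in>E. cmod (cinner x y) \<le> real n}" for n
  have C_eq: "C n = (\<Inter>y\<in>E. {x. cmod (cinner x y) \<le> real n})" for n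
    by (auto simp: C_def)
  have closed: "closed (C n)" for n
    unfolding C_eq
    by (intro closed_INT ballI closed_Collect_le continuous_intros
        bounded_linear.continuous_on[OF bounded_linear_cinner_left])
  have "x \<in> (\<Union>n. C n)" for x
  proof -
    obtain M where M: "\<forall>y\<in>E. cmod (cinner x y) \<le> M"
      using assms by blast
    obtain n where "M \<le> real n"
      using real_arch_simple by blast
    with M have "x \<in> C n"
      by (auto simp: C_def)
    then show ?thesis
      by blast
  qed
  then have "\<Union>(range C) = UNIV"
    by blast
  then have "interior (\<Union>(range C)) \<noteq> {}"
    by simp
  then obtain n where "interior (C n) \<noteq> {}"
    using Baire_category_alt[of "euclidean :: 'a topology" "range C"] closed
    by (auto simp: completely_metrizable_space_euclidean)
  then obtain x e where e: "0 < e" "cball x e \<subseteq> C n"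
    by (metis all_not_in_conv mem_interior_cball)
  show ?thesis
    unfolding bounded_iff
  proof (intro exI ballI)
    fix y
    assume y: "y \<in> E"
    define z where "z = (e / norm y) *\<^sub>R y"
    have "norm z \<le> e"
      using e(1) by (simp add: z_def)
    then have "x + z \<in> C n" "x \<in> C n"
      using e by (auto simp: dist_norm)
    then have "cmod (cinner (x + z) y) \<le> n" "cmod (cinner x y) \<le> n"
      using y by (auto simp: C_def)
    then have "cmod (cinner z y) \<le> 2 * real n"
      using norm_triangle_ineq4[of "cinner (x + z) y" "cinner x y"] by (simp add: cinner_add_left)
    moreover have "cmod (cinner z y) = e * norm y"
      using e(1) by (cases "y = 0") (simp_all add: z_def cinner_self norm_mult norm_divide power2_eq_square)
    ultimately show "norm y \<le> 2 * real n / e"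
      using e(1) by (simp add: field_simps)
  qed
qed

lemma bounded_clinear_if_adjoint:
  assumes T: "bounded_clinear T" and adj: "\<And>x y. cinner (T x) y = cinner x (T' y)"
  shows "bounded_clinear T'"
proof -
  obtain K where K: "0 < K" "\<And>x. norm (T x) \<le> K * norm x"
    using bounded_clinear_pos_bound[OF T] by blast
  show ?thesis
  proof (rule bounded_clinearI[where K = K])
    show "T' (x + y) = T' x + T' y" for x y
      by (rule cinner_eqI) (simp add: cinner_add_right flip: adj)
    show "T' (a *\<^sub>C x) = a *\<^sub>C T' x" for a x
      by (rule cinner_eqI) (simp flip: adj)
    show "norm (T' y) \<le> K * norm y" for y
    proof (cases "T' y = 0")
      case False
      have "(norm (T' y))\<^sup>2 = Re (cinner (T (T' y)) y)"
        by (simp add: adj power2_norm_eq_cinner)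
      also have "\<dots> \<le> norm (T (T' y)) * norm y"
        using complex_Re_le_cmod cmod_cinner_le order_trans by blast
      also have "\<dots> \<le> K * norm (T' y) * norm y"
        by (intro mult_right_mono K) auto
      finally show ?thesis
        using False by (simp add: power2_eq_square)
    qed (use K in simp)
  qed
qed

lemma cadjoint_eqI:
  assumes "\<And>x y. cinner (T x) y = cinner x (T' y)"
  shows "cadjoint T = T'"
  unfolding cadjoint_def
proof (rule the_equality)
  fix R
  assume "\<forall>x y. cinner (T x) y = cinner x (R y)"
  then have "cinner x (R y) = cinner x (T' y)" for x y
    by (simp flip: assms)
  then show "R = T'"
    by (intro ext cinner_eqI)
qed (use assms in simp)

lemma adjoint_bounded_below_if_surj:
  fixes T :: "'a::complex_hilbert_space \<Rightarrow> 'b::complex_hilbert_space"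
  assumes T: "surj T" and T': "bounded_clinear T'"
    and adj: "\<And>x y. cinner (T x) y = cinner x (T' y)"
  obtains K where "0 < K" "\<And>y. norm y \<le> K * norm (T' y)"
proof -
  interpret T': bounded_linear T'
    by (rule bounded_clinear_bounded_linear[OF T'])
  have "bounded {y. norm (T' y) \<le> 1}"
  proof (rule uniform_boundedness)
    fix x
    obtain u where "x = T u"
      using T by (metis surjD)
    then have "cmod (cinner x y) \<le> norm u * norm (T' y)" for y
      using cmod_cinner_le[of u "T' y"] by (simp only: adj)
    moreover have "norm u * norm (T' y) \<le> norm u" if "norm (T' y) \<le> 1" for y
      using mult_left_mono[OF that, of "norm u"] by simp
    ultimately have "\<forall>y\<in>{y. norm (T' y) \<le> 1}. cmod (cinner x y) \<le> norm u"
      by (auto intro: order_trans)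
    then show "\<exists>M. \<forall>y\<in>{y. norm (T' y) \<le> 1}. cmod (cinner x y) \<le> M"
      by blast
  qed
  then obtain K where K: "0 < K" "\<And>y. norm (T' y) \<le> 1 \<Longrightarrow> norm y \<le> K"
    by (auto simp: bounded_pos)
  have ker: "y = 0" if "T' y = 0" for y
  proof (rule cinner_eqI)
    fix z
    obtain u where "z = T u"
      using T by (metis surjD)
    then show "cinner z y = cinner z 0"
      by (simp add: adj that T'.zero)
  qed
  have "norm y \<le> K * norm (T' y)" for y
  proof (cases "T' y = 0")
    case True
    then show ?thesis
      using ker by simp
  next
    case False
    then have "norm ((1 / norm (T' y)) *\<^sub>R y) \<le> K"
      by (intro K) (simp add: T'.scaleR)
    then show ?thesis
      using False by (simp add: field_simps)
  qed
  with K(1) show thesis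
    by (rule that)
qed

text \<open>Here \<open>T T'\<close> is coercive, so that the inverse of \<open>T\<close> is \<open>T' (T T')\<^sup>-\<^sup>1\<close>.\<close>

lemma bounded_clinear_inv:
  assumes T: "bounded_clinear T" "bij T"
    and adj: "\<And>x y. cinner (T x) y = cinner x (T' y)"
  shows "bounded_clinear (inv T)"
proof -
  have T': "bounded_clinear T'"
    by (rule bounded_clinear_if_adjoint[OF T(1) adj])
  obtain K where K: "0 < K" "\<And>y. norm y \<le> K * norm (T' y)"
    using adjoint_bounded_below_if_surj[OF bij_is_surj[OF T(2)] T' adj] by blast
  have comp: "bounded_clinear (T \<circ> T')"
    by (intro bounded_clinear_compose T T')
  have coercive: "1 / K\<^sup>2 * (norm y)\<^sup>2 \<le> Re (cinner ((T \<circ> T') y) y)" for y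
  proof -
    have "(norm y)\<^sup>2 \<le> K\<^sup>2 * (norm (T' y))\<^sup>2"
      using power_mono[OF K(2)[of y], of 2] by (simp add: power_mult_distrib)
    then have "1 / K\<^sup>2 * (norm y)\<^sup>2 \<le> (norm (T' y))\<^sup>2"
      using K(1) by (simp add: pos_divide_le_eq mult.commute)
    then show ?thesis
      by (simp add: adj power2_norm_eq_cinner[of "T' y"])
  qed
  have pos: "0 < 1 / K\<^sup>2"
    using K(1) by simp
  have "T (T' (inv (T \<circ> T') y)) = y" for y
  proof -
    have "(T \<circ> T') (inv (T \<circ> T') y) = y"
      by (rule surj_f_inv_f[OF bij_is_surj[OF lax_milgram(1)[OF comp pos coercive]]])
    then show ?thesis
      by simp
  qed
  then have "inv T y = T' (inv (T \<circ> T') y)" for y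
    by (metis T(2) bij_inv_eq_iff)
  then have inv_eq: "inv T = T' \<circ> inv (T \<circ> T')"
    by (simp add: fun_eq_iff)
  show ?thesis
    unfolding inv_eq by (intro bounded_clinear_compose T' lax_milgram(2)[OF comp pos coercive])
qed

section \<open>Frames\<close>

definition bessel :: "real \<Rightarrow> (nat \<Rightarrow> 'a::complex_hilbert_space) \<Rightarrow> bool" where
  "bessel B \<phi> \<longleftrightarrow> (\<forall>h I. finite I \<longrightarrow> (\<Sum>n\<in>I. (cmod (cinner h (\<phi> n)))\<^sup>2) \<le> B * (norm h)\<^sup>2)"

lemma bessel_summable: "bessel B \<phi> \<Longrightarrow> summable (\<lambda>n. (cmod (cinner h (\<phi> n)))\<^sup>2)"
  by (rule summableI_nonneg_bounded[where x = "B * (norm h)\<^sup>2"]) (auto simp: bessel_def)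

lemma bessel_suminf_le: "bessel B \<phi> \<Longrightarrow> (\<Sum>n. (cmod (cinner h (\<phi> n)))\<^sup>2) \<le> B * (norm h)\<^sup>2"
  by (intro suminf_le_const bessel_summable) (auto simp: bessel_def)

lemma is_frameE:
  assumes "is_frame \<phi>"
  obtains A B where "0 < A" "0 < B" "bessel B \<phi>"
    "\<And>h. A * (norm h)\<^sup>2 \<le> (\<Sum>n. (cmod (cinner h (\<phi> n)))\<^sup>2)"
proof -
  obtain A B where AB: "0 < A" "A \<le> B"
    and bounds: "\<And>h. summable (\<lambda>n. (cmod (cinner h (\<phi> n)))\<^sup>2)"
      "\<And>h. A * (norm h)\<^sup>2 \<le> (\<Sum>n. (cmod (cinner h (\<phi> n)))\<^sup>2)"
      "\<And>h. (\<Sum>n. (cmod (cinner h (\<phi> n)))\<^sup>2) \<le> B * (norm h)\<^sup>2"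
    using assms unfolding is_frame_def by blast
  have "(\<Sum>n\<in>I. (cmod (cinner h (\<phi> n)))\<^sup>2) \<le> B * (norm h)\<^sup>2" if "finite I" for h I
    using sum_le_suminf[OF bounds(1) that, of h] bounds(3)[of h] by simp
  then show thesis
    using AB bounds(2) by (intro that[of A B]) (auto simp: bessel_def)
qed

lemma is_frameI:
  assumes "0 < A" and B: "bessel B \<phi>"
    and "\<And>h. A * (norm h)\<^sup>2 \<le> (\<Sum>n. (cmod (cinner h (\<phi> n)))\<^sup>2)"
  shows "is_frame \<phi>"
  unfolding is_frame_def
proof (rule exI[of _ A], rule exI[of _ "max A B"], intro conjI allI)
  show "(\<Sum>n. (cmod (cinner h (\<phi> n)))\<^sup>2) \<le> max A B * (norm h)\<^sup>2" for h
    using bessel_suminf_le[OF B, of h] mult_right_mono[of B "max A B" "(norm h)\<^sup>2"] by simp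
qed (use assms in \<open>auto intro: bessel_summable\<close>)

lemma sum_norm_mult_le_L2_set:
  "(\<Sum>n\<in>I. cmod (c n) * cmod (d n)) \<le> L2_set (\<lambda>n. cmod (c n)) I * L2_set (\<lambda>n. cmod (d n)) I"
  using L2_set_mult_ineq[of "\<lambda>n. cmod (c n)" "\<lambda>n. cmod (d n)" I] by simp

lemma cinner_sum_left: "cinner (\<Sum>n\<in>I. f n) y = (\<Sum>n\<in>I. cinner (f n) y)"
  by (rule linear_sum[OF bounded_linear.linear[OF bounded_linear_cinner_left]])

lemma bessel_norm_sum_le:
  assumes B: "bessel B \<phi>" "0 \<le> B" and I: "finite I"
  shows "norm (\<Sum>n\<in>I. c n *\<^sub>C \<phi> n) \<le> sqrt B * L2_set (\<lambda>n. cmod (c n)) I"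
proof -
  define g where "g = (\<Sum>n\<in>I. c n *\<^sub>C \<phi> n)"
  have "(norm g)\<^sup>2 = cmod (cinner g g)"
    by (simp add: cinner_self norm_power)
  also have "\<dots> = cmod (\<Sum>n\<in>I. c n * cinner (\<phi> n) g)"
    by (subst g_def, simp only: cinner_sum_left cinner_scaleC_left)
  also have "\<dots> \<le> (\<Sum>n\<in>I. cmod (c n) * cmod (cinner (\<phi> n) g))"
    by (rule order_trans[OF norm_sum]) (simp add: norm_mult)
  also have "\<dots> \<le> L2_set (\<lambda>n. cmod (c n)) I * L2_set (\<lambda>n. cmod (cinner (\<phi> n) g)) I"
    by (rule sum_norm_mult_le_L2_set)
  also have "\<dots> \<le> L2_set (\<lambda>n. cmod (c n)) I * (sqrt B * norm g)"
  proof (rule mult_left_mono)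
    have "L2_set (\<lambda>n. cmod (cinner (\<phi> n) g)) I = sqrt (\<Sum>n\<in>I. (cmod (cinner g (\<phi> n)))\<^sup>2)"
      unfolding L2_set_def by (simp add: cinner_commute[of g])
    also have "\<dots> \<le> sqrt (B * (norm g)\<^sup>2)"
      using B I by (simp add: bessel_def)
    finally show "L2_set (\<lambda>n. cmod (cinner (\<phi> n) g)) I \<le> sqrt B * norm g"
      by (simp add: real_sqrt_mult)
  qed (simp add: L2_set_nonneg)
  finally have "norm g * norm g \<le> (sqrt B * L2_set (\<lambda>n. cmod (c n)) I) * norm g"
    by (simp add: power2_eq_square mult_ac)
  then have "norm g \<le> sqrt B * L2_set (\<lambda>n. cmod (c n)) I"
    using B(2) by (cases "g = 0") (simp_all add: L2_set_nonneg)
  then show ?thesis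
    by (simp add: g_def)
qed

lemma bessel_summable_scaleC:
  assumes B: "bessel B \<phi>" "0 \<le> B" and c: "summable (\<lambda>n. (cmod (c n))\<^sup>2)"
  shows "summable (\<lambda>n. c n *\<^sub>C \<phi> n)"
  unfolding summable_Cauchy
proof (intro allI impI)
  fix e :: real
  assume e: "0 < e"
  define d where "d = (e / (sqrt B + 1))\<^sup>2"
  have d: "0 < d"
    using e B(2) by (simp add: d_def add_nonneg_pos order.strict_implies_not_eq[symmetric])
  obtain N where N: "\<And>m n. N \<le> m \<Longrightarrow> norm (\<Sum>i=m..<n. (cmod (c i))\<^sup>2) < d"
    using c d unfolding summable_Cauchy by blast
  have "norm (\<Sum>i=m..<n. c i *\<^sub>C \<phi> i) < e" if "N \<le> m" for m n
  proof -
    have "L2_set (\<lambda>i. cmod (c i)) {m..<n} < sqrt d"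
      using N[OF that, of n] unfolding L2_set_def by simp
    moreover have "sqrt d = e / (sqrt B + 1)"
      using e B(2) by (simp add: d_def)
    ultimately have "(sqrt B + 1) * L2_set (\<lambda>i. cmod (c i)) {m..<n} < e"
      using B(2) by (simp add: pos_less_divide_eq add_nonneg_pos mult.commute)
    moreover have "sqrt B * L2_set (\<lambda>i. cmod (c i)) {m..<n}
        \<le> (sqrt B + 1) * L2_set (\<lambda>i. cmod (c i)) {m..<n}"
      by (intro mult_right_mono) (auto simp: L2_set_nonneg)
    ultimately show ?thesis
      using bessel_norm_sum_le[OF B, of "{m..<n}" c] by simp
  qed
  then show "\<exists>N. \<forall>m\<ge>N. \<forall>n. norm (\<Sum>i=m..<n. c i *\<^sub>C \<phi> i) < e"
    by blast
qed

lemma bounded_clinear_sum_scaleC: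
  assumes "bounded_clinear T"
  shows "T (\<Sum>n\<in>I. c n *\<^sub>C \<phi> n) = (\<Sum>n\<in>I. c n *\<^sub>C T (\<phi> n))"
  using linear_sum[OF bounded_linear.linear[OF bounded_clinear_bounded_linear[OF assms]],
      of "\<lambda>n. c n *\<^sub>C \<phi> n" I]
  by (simp add: bounded_clinear_scaleC[OF assms])

text \<open>The adjoint of \<open>T\<close> is not available here, since its existence is derived from this lemma;
  instead, test \<open>h\<close> against \<open>T\<close> of the sum with coefficients \<open>\<langle>h, T \<phi>\<^sub>n\<rangle>\<close>.\<close>

lemma bessel_image:
  assumes T: "bounded_clinear T" and B: "bessel B \<phi>" "0 \<le> B"
  obtains B' where "0 < B'" "bessel B' (\<lambda>n. T (\<phi> n))"
proof -
  obtain K where K: "0 < K" "\<And>x. norm (T x) \<le> K * norm x"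
    using bounded_clinear_pos_bound[OF T] by blast
  have "(\<Sum>n\<in>I. (cmod (cinner h (T (\<phi> n))))\<^sup>2) \<le> (K\<^sup>2 * B + 1) * (norm h)\<^sup>2"
    if I: "finite I" for h I
  proof -
    define c where "c n = cinner h (T (\<phi> n))" for n
    define s where "s = L2_set (\<lambda>n. cmod (c n)) I"
    have s2: "s\<^sup>2 = (\<Sum>n\<in>I. (cmod (c n))\<^sup>2)"
      by (simp add: s_def L2_set_def sum_nonneg)
    have s0: "0 \<le> s"
      by (simp add: s_def L2_set_nonneg)
    have "cinner (T (\<Sum>n\<in>I. c n *\<^sub>C \<phi> n)) h = (\<Sum>n\<in>I. c n * cnj (c n))"
      by (simp add: bounded_clinear_sum_scaleC[OF T] cinner_sum_left c_def cinner_commute[of "T _" h])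
    also have "\<dots> = complex_of_real (s\<^sup>2)"
      by (simp add: s2 flip: complex_norm_square)
    finally have "s\<^sup>2 = cmod (cinner (T (\<Sum>n\<in>I. c n *\<^sub>C \<phi> n)) h)"
      by (simp add: norm_power)
    also have "\<dots> \<le> norm (T (\<Sum>n\<in>I. c n *\<^sub>C \<phi> n)) * norm h"
      by (rule cmod_cinner_le)
    also have "\<dots> \<le> (K * (sqrt B * s)) * norm h"
      unfolding s_def using K(1) bessel_norm_sum_le[OF B I, of c]
      by (intro mult_right_mono order_trans[OF K(2)] mult_left_mono) auto
    finally have "s * s \<le> (K * sqrt B * norm h) * s"
      by (simp add: power2_eq_square mult_ac)
    then have "s \<le> K * sqrt B * norm h"
      using s0 K(1) B(2) by (cases "s = 0") simp_all
    then have "s\<^sup>2 \<le> (K * sqrt B * norm h)\<^sup>2"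
      using s0 by (rule power_mono)
    also have "\<dots> \<le> (K\<^sup>2 * B + 1) * (norm h)\<^sup>2"
      using B(2) by (simp add: power_mult_distrib algebra_simps)
    finally show ?thesis
      by (simp add: s2 c_def)
  qed
  moreover have "0 < K\<^sup>2 * B + 1"
    using B(2) by (simp add: add_nonneg_pos)
  ultimately show thesis
    by (intro that[of "K\<^sup>2 * B + 1"]) (auto simp: bessel_def)
qed

text \<open>Composition of the synthesis operator of \<open>\<phi>\<close> with the analysis operator of \<open>\<psi>\<close>.\<close>

definition mixed_operator ::
    "(nat \<Rightarrow> 'a::complex_hilbert_space) \<Rightarrow> (nat \<Rightarrow> 'b::complex_hilbert_space) \<Rightarrow> 'b \<Rightarrow> 'a" where
  "mixed_operator \<phi> \<psi> f = (\<Sum>n. cinner f (\<psi> n) *\<^sub>C \<phi> n)"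

lemma frame_operator_eq_mixed: "frame_operator \<phi> = mixed_operator \<phi> \<phi>"
  by (simp add: fun_eq_iff frame_operator_def mixed_operator_def)

lemma mixed_operator_summable:
  assumes "bessel B \<phi>" "0 \<le> B" "bessel C \<psi>"
  shows "summable (\<lambda>n. cinner f (\<psi> n) *\<^sub>C \<phi> n)"
  by (intro bessel_summable_scaleC[OF assms(1,2)] bessel_summable[OF assms(3)])

lemma cinner_mixed_operator_left:
  assumes "bessel B \<phi>" "0 \<le> B" "bessel C \<psi>"
  shows "cinner (mixed_operator \<phi> \<psi> f) g = (\<Sum>n. cinner f (\<psi> n) * cinner (\<phi> n) g)"
    and "summable (\<lambda>n. cinner f (\<psi> n) * cinner (\<phi> n) g)"
  using bounded_linear.suminf[OF bounded_linear_cinner_left mixed_operator_summable[OF assms, of f], of g]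
    bounded_linear.summable[OF bounded_linear_cinner_left mixed_operator_summable[OF assms, of f], of g]
  by (simp_all add: mixed_operator_def)

lemma cinner_mixed_operator_right:
  assumes "bessel B \<phi>" "0 \<le> B" "bessel C \<psi>"
  shows "cinner g (mixed_operator \<phi> \<psi> f) = (\<Sum>n. cinner g (\<phi> n) * cinner (\<psi> n) f)"
  using bounded_linear.suminf[OF bounded_linear_cinner_right mixed_operator_summable[OF assms, of f], of g]
  by (simp add: mixed_operator_def cinner_commute[of "\<psi> _" f] mult.commute)

lemma mixed_operator_adjoint:
  assumes "bessel B \<phi>" "0 \<le> B" "bessel C \<psi>" "0 \<le> C"
  shows "cinner (mixed_operator \<phi> \<psi> f) g = cinner f (mixed_operator \<psi> \<phi> g)"
  by (simp add: cinner_mixed_operator_left[OF assms(1-3)] cinner_mixed_operator_right[OF assms(3,4,1)])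

lemma mixed_operator_bounded_clinear:
  assumes "bessel B \<phi>" "0 \<le> B" "bessel C \<psi>" "0 \<le> C"
  shows "bounded_clinear (mixed_operator \<phi> \<psi>)"
proof (rule bounded_clinearI[where K = "sqrt B * sqrt C"])
  note summable = mixed_operator_summable[OF assms(1-3)]
  show "mixed_operator \<phi> \<psi> (x + y) = mixed_operator \<phi> \<psi> x + mixed_operator \<phi> \<psi> y" for x y
    by (simp add: mixed_operator_def cinner_add_left scaleC_add_left suminf_add[OF summable summable])
  show "mixed_operator \<phi> \<psi> (a *\<^sub>C x) = a *\<^sub>C mixed_operator \<phi> \<psi> x" for a x
  proof -
    have "bounded_linear ((*\<^sub>C) a :: 'a \<Rightarrow> 'a)"
      by (rule bounded_linear_intro[where K = "cmod a"])
        (simp_all add: scaleC_add_right scaleR_scaleC mult.commute)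
    from bounded_linear.suminf[OF this summable[of x]] show ?thesis
      by (simp add: mixed_operator_def)
  qed
  show "norm (mixed_operator \<phi> \<psi> x) \<le> sqrt B * sqrt C * norm x" for x
  proof (rule LIMSEQ_le_const2)
    show "(\<lambda>N. norm (\<Sum>n<N. cinner x (\<psi> n) *\<^sub>C \<phi> n)) \<longlonglongrightarrow> norm (mixed_operator \<phi> \<psi> x)"
      unfolding mixed_operator_def by (intro tendsto_norm summable_LIMSEQ summable)
    have "norm (\<Sum>n<N. cinner x (\<psi> n) *\<^sub>C \<phi> n) \<le> sqrt B * sqrt C * norm x" for N
    proof -
      have "L2_set (\<lambda>n. cmod (cinner x (\<psi> n))) {..<N} \<le> sqrt (C * (norm x)\<^sup>2)"
        unfolding L2_set_def using assms(3) by (simp add: bessel_def)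
      then have "sqrt B * L2_set (\<lambda>n. cmod (cinner x (\<psi> n))) {..<N} \<le> sqrt B * sqrt (C * (norm x)\<^sup>2)"
        using assms(2) by (simp add: mult_left_mono)
      with bessel_norm_sum_le[OF assms(1,2), of "{..<N}" "\<lambda>n. cinner x (\<psi> n)"] show ?thesis
        by (simp add: real_sqrt_mult)
    qed
    then show "\<exists>N. \<forall>n\<ge>N. norm (\<Sum>n<n. cinner x (\<psi> n) *\<^sub>C \<phi> n) \<le> sqrt B * sqrt C * norm x"
      by blast
  qed
qed

lemma cinner_frame_operator_self:
  assumes "bessel B \<phi>" "0 \<le> B"
  shows "cinner (frame_operator \<phi> h) h = complex_of_real (\<Sum>n. (cmod (cinner h (\<phi> n)))\<^sup>2)"
proof -
  have "cinner (frame_operator \<phi> h) h = (\<Sum>n. complex_of_real ((cmod (cinner h (\<phi> n)))\<^sup>2))"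
    by (simp only: frame_operator_eq_mixed cinner_mixed_operator_left[OF assms assms(1)]
        complex_norm_square cinner_commute[of "\<phi> _" h])
  then show ?thesis
    by (simp only: suminf_of_real[OF bessel_summable[OF assms(1)]])
qed

lemma frame_operator_invertible:
  assumes "is_frame \<phi>"
  shows "bounded_clinear (frame_operator \<phi>)" "bij (frame_operator \<phi>)"
    "bounded_clinear (inv (frame_operator \<phi>))"
proof -
  obtain A B where A: "0 < A" and B: "0 \<le> B" "bessel B \<phi>"
    and lower: "\<And>h. A * (norm h)\<^sup>2 \<le> (\<Sum>n. (cmod (cinner h (\<phi> n)))\<^sup>2)"
    using is_frameE[OF assms] by (metis less_eq_real_def)
  show bounded: "bounded_clinear (frame_operator \<phi>)"
    unfolding frame_operator_eq_mixed by (rule mixed_operator_bounded_clinear[OF B(2,1) B(2,1)])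
  have coercive: "A * (norm h)\<^sup>2 \<le> Re (cinner (frame_operator \<phi> h) h)" for h
    using lower by (simp add: cinner_frame_operator_self[OF B(2,1)])
  show "bij (frame_operator \<phi>)" "bounded_clinear (inv (frame_operator \<phi>))"
    by (rule lax_milgram[OF bounded A coercive])+
qed

text \<open>A frame makes adjoints explicit: \<open>T\<^sup>* y = S\<^sup>-\<^sup>1 (\<Sum>n. \<langle>y, T \<phi>\<^sub>n\<rangle> \<phi>\<^sub>n)\<close>, by expanding \<open>x\<close> as
  \<open>S (S\<^sup>-\<^sup>1 x)\<close> in \<open>\<langle>T x, y\<rangle>\<close>. No representation theorem is needed.\<close>

lemma adjoint_exists_if_frame:
  fixes T :: "'a::complex_hilbert_space \<Rightarrow> 'b::complex_hilbert_space"
  assumes frame: "is_frame (\<phi> :: nat \<Rightarrow> 'a)" and T: "bounded_clinear T"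
  obtains T' where "\<And>x y. cinner (T x) y = cinner x (T' y)"
proof -
  define S where "S = frame_operator \<phi>"
  obtain B where B: "0 \<le> B" "bessel B \<phi>"
    using is_frameE[OF frame] by (metis less_eq_real_def)
  obtain C where C: "0 < C" "bessel C (\<lambda>n. T (\<phi> n))"
    using bessel_image[OF T B(2,1)] by blast
  have S_inv: "S (inv S x) = x" for x
    using frame_operator_invertible(2)[OF frame] by (simp add: S_def bij_is_surj surj_f_inv_f)
  have S_sym: "cinner (S x) y = cinner x (S y)" for x y
    unfolding S_def frame_operator_eq_mixed by (rule mixed_operator_adjoint[OF B(2,1) B(2,1)])
  have TS: "T (S x) = mixed_operator (\<lambda>n. T (\<phi> n)) \<phi> x" for x
    using bounded_linear.suminf[OF bounded_clinear_bounded_linear[OF T] mixed_operator_summable[OF B(2,1) B(2)]]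
    by (simp add: S_def frame_operator_eq_mixed mixed_operator_def bounded_clinear_scaleC[OF T])
  have "cinner (T x) y = cinner x (inv S (mixed_operator \<phi> (\<lambda>n. T (\<phi> n)) y))" for x y
  proof -
    have "cinner (T x) y = cinner (mixed_operator (\<lambda>n. T (\<phi> n)) \<phi> (inv S x)) y"
      by (metis TS S_inv)
    also have "\<dots> = cinner (inv S x) (mixed_operator \<phi> (\<lambda>n. T (\<phi> n)) y)"
      using C B by (intro mixed_operator_adjoint[where B = C and C = B]) auto
    also have "\<dots> = cinner x (inv S (mixed_operator \<phi> (\<lambda>n. T (\<phi> n)) y))"
      by (metis S_inv S_sym)
    finally show ?thesis .
  qed
  then show thesis
    by (rule that)
qed

lemma is_frame_image:
  fixes T :: "'a::complex_hilbert_space \<Rightarrow> 'b::complex_hilbert_space"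
  assumes frame: "is_frame (\<phi> :: nat \<Rightarrow> 'a)" and T: "bounded_clinear T" "surj T"
  shows "is_frame (\<lambda>n. T (\<phi> n))"
proof -
  obtain A B where A: "0 < A" and B: "0 \<le> B" "bessel B \<phi>"
    and lower: "\<And>h. A * (norm h)\<^sup>2 \<le> (\<Sum>n. (cmod (cinner h (\<phi> n)))\<^sup>2)"
    using is_frameE[OF frame] by (metis less_eq_real_def)
  obtain C where C: "bessel C (\<lambda>n. T (\<phi> n))"
    using bessel_image[OF T(1) B(2,1)] by blast
  obtain T' where adj: "\<And>x y. cinner (T x) y = cinner x (T' y)"
    using adjoint_exists_if_frame[OF frame T(1)] by blast
  have coeff: "cmod (cinner h (T x)) = cmod (cinner (T' h) x)" for h x
    by (metis adj cinner_commute complex_mod_cnj)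
  obtain K where K: "0 < K" "\<And>y. norm y \<le> K * norm (T' y)"
    using adjoint_bounded_below_if_surj[OF T(2) bounded_clinear_if_adjoint[OF T(1) adj] adj] by blast
  show ?thesis
  proof (rule is_frameI[OF _ C])
    show "0 < A / K\<^sup>2"
      using A K(1) by simp
    fix h
    have "(norm h)\<^sup>2 \<le> (norm (T' h))\<^sup>2 * K\<^sup>2"
      using power_mono[OF K(2)[of h], of 2] by (simp add: power_mult_distrib mult.commute)
    then have "(norm h)\<^sup>2 / K\<^sup>2 \<le> (norm (T' h))\<^sup>2"
      using K(1) by (simp add: pos_divide_le_eq)
    then have "A / K\<^sup>2 * (norm h)\<^sup>2 \<le> A * (norm (T' h))\<^sup>2"
      using mult_left_mono[of "(norm h)\<^sup>2 / K\<^sup>2" "(norm (T' h))\<^sup>2" A] A by simp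
    also have "\<dots> \<le> (\<Sum>n. (cmod (cinner h (T (\<phi> n))))\<^sup>2)"
      using lower[of "T' h"] by (simp add: coeff)
    finally show "A / K\<^sup>2 * (norm h)\<^sup>2 \<le> (\<Sum>n. (cmod (cinner h (T (\<phi> n))))\<^sup>2)" .
  qed
qed

lemma is_frame_weighted:
  assumes frame: "is_frame \<phi>" and "0 < a" and w: "\<And>n. a \<le> w n" "\<And>n. w n \<le> b"
  shows "is_frame (\<lambda>n. sqrt (w n) *\<^sub>R \<phi> n)"
proof -
  obtain A B where A: "0 < A" and B: "0 < B" "bessel B \<phi>"
    and lower: "\<And>h. A * (norm h)\<^sup>2 \<le> (\<Sum>n. (cmod (cinner h (\<phi> n)))\<^sup>2)"
    using is_frameE[OF frame] by blast
  have w_pos: "0 < w n" for n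
    using \<open>0 < a\<close> w(1)[of n] by linarith
  have coeff: "(cmod (cinner h (sqrt (w n) *\<^sub>R \<phi> n)))\<^sup>2 = w n * (cmod (cinner h (\<phi> n)))\<^sup>2" for h n
    using w_pos[of n] by (simp add: norm_mult power_mult_distrib)
  have bessel: "bessel (b * B) (\<lambda>n. sqrt (w n) *\<^sub>R \<phi> n)"
    unfolding bessel_def coeff
  proof (intro allI impI)
    fix h and I :: "nat set"
    assume I: "finite I"
    have "0 \<le> b"
      using w_pos[of 0] w(2)[of 0] by linarith
    have "(\<Sum>n\<in>I. w n * (cmod (cinner h (\<phi> n)))\<^sup>2) \<le> (\<Sum>n\<in>I. b * (cmod (cinner h (\<phi> n)))\<^sup>2)"
      by (intro sum_mono mult_right_mono w) auto
    also have "\<dots> \<le> b * (B * (norm h)\<^sup>2)"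
      using B(2) I \<open>0 \<le> b\<close> unfolding sum_distrib_left[symmetric]
      by (intro mult_left_mono) (auto simp: bessel_def)
    finally show "(\<Sum>n\<in>I. w n * (cmod (cinner h (\<phi> n)))\<^sup>2) \<le> b * B * (norm h)\<^sup>2"
      by (simp add: mult.assoc)
  qed
  show ?thesis
  proof (rule is_frameI[OF _ bessel])
    show "0 < a * A"
      using \<open>0 < a\<close> A by simp
    fix h
    have "a * A * (norm h)\<^sup>2 \<le> a * (\<Sum>n. (cmod (cinner h (\<phi> n)))\<^sup>2)"
      using mult_left_mono[OF lower[of h], of a] \<open>0 < a\<close> by (simp add: mult.assoc)
    also have "\<dots> = (\<Sum>n. a * (cmod (cinner h (\<phi> n)))\<^sup>2)"
      by (rule suminf_mult[symmetric, OF bessel_summable[OF B(2)]])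
    also have "\<dots> \<le> (\<Sum>n. w n * (cmod (cinner h (\<phi> n)))\<^sup>2)"
    proof (rule suminf_le)
      show "a * (cmod (cinner h (\<phi> n)))\<^sup>2 \<le> w n * (cmod (cinner h (\<phi> n)))\<^sup>2" for n
        by (intro mult_right_mono w) auto
      show "summable (\<lambda>n. a * (cmod (cinner h (\<phi> n)))\<^sup>2)"
        by (intro summable_mult bessel_summable[OF B(2)])
      show "summable (\<lambda>n. w n * (cmod (cinner h (\<phi> n)))\<^sup>2)"
        using bessel_summable[OF bessel, of h] by (simp only: coeff)
    qed
    finally show "a * A * (norm h)\<^sup>2 \<le> (\<Sum>n. (cmod (cinner h (sqrt (w n) *\<^sub>R \<phi> n)))\<^sup>2)"
      by (simp only: coeff)
  qed
qed

section \<open>Multipliers\<close>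

lemma multiplier_invertibleI:
  assumes "\<And>f. summable (\<lambda>n. m n *\<^sub>C cinner f (\<psi> n) *\<^sub>C \<phi> n)" and "bij (multiplier m \<phi> \<psi>)"
    and "bounded_clinear (inv (multiplier m \<phi> \<psi>))"
  shows "multiplier_invertible m \<phi> \<psi>"
  unfolding multiplier_invertible_def
proof (intro conjI allI exI[of _ "inv (multiplier m \<phi> \<psi>)"])
  show "inv (multiplier m \<phi> \<psi>) \<circ> multiplier m \<phi> \<psi> = id"
    by (rule inv_o_cancel[OF bij_is_inj[OF assms(2)]])
  show "multiplier m \<phi> \<psi> \<circ> inv (multiplier m \<phi> \<psi>) = id"
    using bij_is_surj[OF assms(2)] by (simp add: surj_iff)
qed (fact assms)+

lemma multiplier_uminus:
  assumes "multiplier_invertible m \<phi> \<psi>"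
  shows "multiplier_invertible (\<lambda>n. - m n) \<phi> \<psi>"
    and "inv (multiplier (\<lambda>n. - m n) \<phi> \<psi>) = (\<lambda>f. - inv (multiplier m \<phi> \<psi>) f)"
proof -
  obtain N where summable: "\<And>f. summable (\<lambda>n. m n *\<^sub>C cinner f (\<psi> n) *\<^sub>C \<phi> n)"
    and N: "bounded_clinear N" "N \<circ> multiplier m \<phi> \<psi> = id" "multiplier m \<phi> \<psi> \<circ> N = id"
    using assms unfolding multiplier_invertible_def by blast
  have minus: "multiplier (\<lambda>n. - m n) \<phi> \<psi> f = - multiplier m \<phi> \<psi> f" for f
    using suminf_minus[OF summable[of f]] by (simp add: multiplier_def)
  have N_minus: "N (- f) = - N f" for f
    using bounded_linear.linear[OF bounded_clinear_bounded_linear[OF N(1)]] by (rule linear_neg)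
  have left: "- N (multiplier (\<lambda>n. - m n) \<phi> \<psi> f) = f" for f
    using fun_cong[OF N(2), of f] by (simp add: minus N_minus)
  have right: "multiplier (\<lambda>n. - m n) \<phi> \<psi> (- N f) = f" for f
    using fun_cong[OF N(3), of "- f"] by (simp add: minus N_minus)
  show "inv (multiplier (\<lambda>n. - m n) \<phi> \<psi>) = (\<lambda>f. - inv (multiplier m \<phi> \<psi>) f)"
    unfolding inv_unique_comp[OF N(3,2)] by (rule inv_equality) (fact left right)+
  show "multiplier_invertible (\<lambda>n. - m n) \<phi> \<psi>"
    unfolding multiplier_invertible_def
    using summable_minus[OF summable] left right
    by (auto simp: fun_eq_iff intro!: exI[of _ "\<lambda>f. - N f"] bounded_clinear_minus[OF N(1)])
qed

lemma multiplier_pos: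
  fixes \<phi> :: "nat \<Rightarrow> 'a::complex_hilbert_space"
  assumes frame: "is_frame \<phi>" and G: "bounded_clinear G" "bij G"
    and "0 < a" and w: "\<And>n. a \<le> w n" "\<And>n. w n \<le> b"
  defines "M1 \<equiv> multiplier (\<lambda>n. complex_of_real (w n)) \<phi> (\<lambda>n. G (\<phi> n))"
    and "M2 \<equiv> multiplier (\<lambda>n. complex_of_real (w n)) (\<lambda>n. G (\<phi> n)) \<phi>"
    and "S \<equiv> frame_operator (\<lambda>n. sqrt (w n) *\<^sub>R \<phi> n)"
  shows "multiplier_invertible (\<lambda>n. complex_of_real (w n)) \<phi> (\<lambda>n. G (\<phi> n))"
    and "multiplier_invertible (\<lambda>n. complex_of_real (w n)) (\<lambda>n. G (\<phi> n)) \<phi>"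
    and "inv M1 = cadjoint (inv G) \<circ> inv S"
    and "inv M2 = inv S \<circ> inv G"
proof -
  have w_pos: "0 < w n" for n
    using \<open>0 < a\<close> w(1)[of n] by linarith
  have frame_w: "is_frame (\<lambda>n. sqrt (w n) *\<^sub>R \<phi> n)"
    using frame \<open>0 < a\<close> w by (rule is_frame_weighted)
  note S = frame_operator_invertible[OF frame_w, folded S_def]
  obtain B where B: "0 \<le> B" "bessel B (\<lambda>n. sqrt (w n) *\<^sub>R \<phi> n)"
    using is_frameE[OF frame_w] by (metis less_eq_real_def)
  obtain G' where G': "\<And>x y. cinner (G x) y = cinner x (G' y)"
    using adjoint_exists_if_frame[OF frame G(1)] by blast
  have invG: "bounded_clinear (inv G)"
    by (rule bounded_clinear_inv[OF G G'])
  obtain H where H: "\<And>x y. cinner (inv G x) y = cinner x (H y)"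
    using adjoint_exists_if_frame[OF frame invG] by blast
  have H_eq: "cadjoint (inv G) = H"
    using H by (rule cadjoint_eqI)
  have H_bounded: "bounded_clinear H"
    by (rule bounded_clinear_if_adjoint[OF invG H])
  have G_inv: "G (inv G x) = x" and inv_G: "inv G (G x) = x" for x
    using G(2) by (simp_all add: bij_is_surj surj_f_inv_f bij_is_inj)
  have HG': "H (G' x) = x" for x
    by (rule cinner_eqI) (simp add: G_inv flip: H G')
  have G'H: "G' (H x) = x" for x
    by (rule cinner_eqI) (simp add: inv_G flip: H G')
  have weight: "complex_of_real (w n) *\<^sub>C cinner f (\<phi> n) *\<^sub>C x
      = cinner f (sqrt (w n) *\<^sub>R \<phi> n) *\<^sub>C sqrt (w n) *\<^sub>R x" for f n and x :: 'a
  proof -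
    have "complex_of_real (w n) = of_real (sqrt (w n)) * of_real (sqrt (w n))"
      using w_pos[of n] by (simp flip: of_real_mult)
    then show ?thesis
      by (simp add: scaleR_scaleC mult_ac)
  qed
  have cinner_G: "cinner f (G x) = cinner (G' f) x" for f x
    by (metis G' cinner_commute)
  note summable = mixed_operator_summable[OF B(2,1) B(2)]
  have summable1: "summable (\<lambda>n. complex_of_real (w n) *\<^sub>C cinner f (G (\<phi> n)) *\<^sub>C \<phi> n)" for f
    unfolding cinner_G weight by (rule summable)
  have G_weight: "complex_of_real (w n) *\<^sub>C cinner f (\<phi> n) *\<^sub>C G (\<phi> n)
      = G (cinner f (sqrt (w n) *\<^sub>R \<phi> n) *\<^sub>C sqrt (w n) *\<^sub>R \<phi> n)" for f n
    unfolding weight by (simp add: bounded_clinear_scaleC[OF G(1)] scaleR_scaleC)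
  have summable2: "summable (\<lambda>n. complex_of_real (w n) *\<^sub>C cinner f (\<phi> n) *\<^sub>C G (\<phi> n))" for f
    unfolding G_weight
    by (intro bounded_linear.summable[OF bounded_clinear_bounded_linear[OF G(1)]] summable)
  have M1: "M1 f = S (G' f)" for f
    by (simp only: M1_def S_def multiplier_def frame_operator_def cinner_G weight)
  have M2: "M2 f = G (S f)" for f
    unfolding M2_def S_def multiplier_def frame_operator_def G_weight
    by (rule bounded_linear.suminf[OF bounded_clinear_bounded_linear[OF G(1)] summable, symmetric])
  have S_inv: "S (inv S x) = x" and inv_S: "inv S (S x) = x" for x
    using S(2) by (simp_all add: bij_is_surj surj_f_inv_f bij_is_inj)
  show inv1: "inv M1 = cadjoint (inv G) \<circ> inv S"
    by (rule inv_equality) (simp_all add: H_eq M1 HG' G'H S_inv inv_S)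
  show inv2: "inv M2 = inv S \<circ> inv G"
    by (rule inv_equality) (simp_all add: M2 G_inv inv_G S_inv inv_S)
  show "multiplier_invertible (\<lambda>n. complex_of_real (w n)) \<phi> (\<lambda>n. G (\<phi> n))"
  proof (rule multiplier_invertibleI[OF summable1], fold M1_def)
    show "bij M1"
      by (rule o_bij[of "H \<circ> inv S"]) (simp_all add: fun_eq_iff M1 HG' G'H S_inv inv_S)
    show "bounded_clinear (inv M1)"
      unfolding inv1 H_eq by (rule bounded_clinear_compose[OF H_bounded S(3)])
  qed
  show "multiplier_invertible (\<lambda>n. complex_of_real (w n)) (\<lambda>n. G (\<phi> n)) \<phi>"
  proof (rule multiplier_invertibleI[OF summable2], fold M2_def)
    show "bij M2"
      by (rule o_bij[of "inv S \<circ> inv G"]) (simp_all add: fun_eq_iff M2 G_inv inv_G S_inv inv_S)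
    show "bounded_clinear (inv M2)"
      unfolding inv2 by (rule bounded_clinear_compose[OF S(3) invG])
  qed
qed

theorem proposition4p5:
  fixes \<phi> \<psi> :: "nat \<Rightarrow> 'a::complex_hilbert_space"
    and G :: "'a \<Rightarrow> 'a"
    and m :: "nat \<Rightarrow> real"
  assumes separable: "separable_space (euclidean :: 'a topology)"
    and infinite_dim: "\<not> (\<exists>B :: 'a set. finite B \<and> complex_vector.span B = UNIV)"
    and frame: "is_frame \<phi>"
    and nonzero: "\<forall>n. \<phi> n \<noteq> 0"
    and G: "bounded_clinear G" "bij G"
    and \<psi>: "\<forall>n. \<psi> n = G (\<phi> n)"
    and sign: "(\<forall>n. 0 < m n) \<or> (\<forall>n. m n < 0)"
    and semi_normalized: "semi_normalized (\<lambda>n. complex_of_real (m n))"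
  shows "is_frame \<psi>
    \<and> multiplier_invertible (\<lambda>n. complex_of_real (m n)) \<phi> \<psi>
    \<and> multiplier_invertible (\<lambda>n. complex_of_real (m n)) \<psi> \<phi>
    \<and> ((\<forall>n. 0 < m n) \<longrightarrow>
         inv (multiplier (\<lambda>n. complex_of_real (m n)) \<phi> \<psi>)
           = cadjoint (inv G) \<circ> inv (frame_operator (\<lambda>n. sqrt (m n) *\<^sub>R \<phi> n))
       \<and> inv (multiplier (\<lambda>n. complex_of_real (m n)) \<psi> \<phi>)
           = inv (frame_operator (\<lambda>n. sqrt (m n) *\<^sub>R \<phi> n)) \<circ> inv G)
    \<and> ((\<forall>n. m n < 0) \<longrightarrow>
         inv (multiplier (\<lambda>n. complex_of_real (m n)) \<phi> \<psi>)
           = (\<lambda>f. - (cadjoint (inv G) \<circ> inv (frame_operator (\<lambda>n. sqrt \<bar>m n\<bar> *\<^sub>R \<phi> n))) f)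
       \<and> inv (multiplier (\<lambda>n. complex_of_real (m n)) \<psi> \<phi>)
           = (\<lambda>f. - (inv (frame_operator (\<lambda>n. sqrt \<bar>m n\<bar> *\<^sub>R \<phi> n)) \<circ> inv G) f))"
proof -
  obtain a b where a: "0 < a" and ab: "\<And>n. a \<le> \<bar>m n\<bar>" "\<And>n. \<bar>m n\<bar> \<le> b"
    using semi_normalized unfolding semi_normalized_def by auto
  have \<psi>_eq: "\<psi> = (\<lambda>n. G (\<phi> n))"
    using \<psi> by auto
  note abs = multiplier_pos[where w = "\<lambda>n. \<bar>m n\<bar>", OF frame G a ab, folded \<psi>_eq]
  have \<psi>_frame: "is_frame \<psi>"
    unfolding \<psi>_eq by (rule is_frame_image[OF frame G(1) bij_is_surj[OF G(2)]])
  from sign show ?thesis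
  proof
    assume pos: "\<forall>n. 0 < m n"
    then have abs_eq: "\<bar>m n\<bar> = m n" for n
      by (simp add: less_imp_le)
    have not_neg: "\<not> (\<forall>n. m n < 0)"
      using pos less_asym by blast
    show ?thesis
      using \<psi>_frame abs[unfolded abs_eq] by (simp add: not_neg)
  next
    assume neg: "\<forall>n. m n < 0"
    then have not_pos: "\<not> (\<forall>n. 0 < m n)"
      using less_asym by blast
    have m_eq: "(\<lambda>n. complex_of_real (m n)) = (\<lambda>n. - complex_of_real \<bar>m n\<bar>)"
      using neg by (simp add: abs_of_neg)
    show ?thesis
      unfolding m_eq
      using \<psi>_frame multiplier_uminus[OF abs(1)] multiplier_uminus[OF abs(2)] abs(3,4)
      by (simp add: not_pos)
  qed
qed

end
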